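(* If $G$ is a split graph on $n$ vertices, then $\chi_{rs}(G)=n-\alpha(G)+1$.
   Context: All graphs are finite, simple and undirected. A split graph is a graph whose vertex set can be partitioned into a clique and an independent set. $\alpha(G)$ is the independence number of $G$. For $k\in\mathbb{N}$, a $k$-restricted star colouring ($k$-rs colouring) of $G$ is a map $f:V(G)\to\{0,\dots,k-1\}$ with $f(x)\neq f(y)$ for every edge $xy$ and with no path $x,y,z$ in $G$ (not necessarily induced) such that $f(y)>f(x)=f(z)$. $\chi_{rs}(G)$ is the least $k$ such that $G$ admits a $k$-rs colouring. *)

theory Defs
  imports "Graph_Theory.Vertex_Walk"
begin

text \<open>
  Finite simple undirected graphs are the instances of the locale \<^locale>\<open>graph\<close>: an undirected
  edge is represented by a pair of opposite arcs, so that \<open>x \<rightarrow>\<^bsub>G\<^esub> y\<close> is the (symmetric and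
  irreflexive) adjacency relation.
\<close>

definition clique :: "('a, 'b) pre_digraph \<Rightarrow> 'a set \<Rightarrow> bool" where
  "clique G K \<longleftrightarrow> K \<subseteq> verts G \<and> (\<forall>x\<in>K. \<forall>y\<in>K. x \<noteq> y \<longrightarrow> x \<rightarrow>\<^bsub>G\<^esub> y)"

definition independent_set :: "('a, 'b) pre_digraph \<Rightarrow> 'a set \<Rightarrow> bool" where
  "independent_set G S \<longleftrightarrow> S \<subseteq> verts G \<and> (\<forall>x\<in>S. \<forall>y\<in>S. \<not> x \<rightarrow>\<^bsub>G\<^esub> y)"

text \<open>Either part of the partition is allowed to be empty.\<close>

definition split_graph :: "('a, 'b) pre_digraph \<Rightarrow> bool" where
  "split_graph G \<longleftrightarrow> graph G \<and>
     (\<exists>K I. K \<union> I = verts G \<and> K \<inter> I = {} \<and> clique G K \<and> independent_set G I)"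

definition independence_number :: "('a, 'b) pre_digraph \<Rightarrow> nat" where
  "independence_number G = Max (card ` {S. independent_set G S})"

text \<open>Colourings are total functions, of which only the values on \<^term>\<open>verts G\<close> matter.\<close>

definition rs_colouring :: "('a, 'b) pre_digraph \<Rightarrow> nat \<Rightarrow> ('a \<Rightarrow> nat) \<Rightarrow> bool" where
  "rs_colouring G k f \<longleftrightarrow>
     (\<forall>x\<in>verts G. f x \<in> {0..<k}) \<and>
     (\<forall>x y. x \<rightarrow>\<^bsub>G\<^esub> y \<longrightarrow> f x \<noteq> f y) \<and>
     \<not> (\<exists>x y z. vpath [x, y, z] G \<and> f y > f x \<and> f x = f z)"

definition rs_chromatic_number :: "('a, 'b) pre_digraph \<Rightarrow> nat" where
  "rs_chromatic_number G = (LEAST k. \<exists>f. rs_colouring G k f)"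

text \<open>
  For finite graphs, the maximum and the minimum above are attained, and subtracting the independence
  number from the number of vertices does not truncate.
\<close>

lemma (in graph) finite_independent_sets: "finite {S. independent_set G S}"
  by (rule finite_subset[of _ "Pow (verts G)"]) (auto simp: independent_set_def)

lemma (in graph) independence_number_attained:
  "\<exists>S. independent_set G S \<and> card S = independence_number G"
proof -
  have "independent_set G {}"
    by (simp add: independent_set_def)
  then have "independence_number G \<in> card ` {S. independent_set G S}"
    unfolding independence_number_def using finite_independent_sets by (intro Max_in) auto
  then show ?thesis
    by auto
qed

lemma (in graph) independence_number_le: "independence_number G \<le> card (verts G)"
  using independence_number_attained
  by (metis independent_set_def card_mono finite_verts)

lemma (in graph) rs_chromatic_number_attained: "\<exists>f. rs_colouring G (rs_chromatic_number G) f"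
proof -
  obtain f :: "'a \<Rightarrow> nat" where f: "bij_betw f (verts G) {0..<card (verts G)}"
    using ex_bij_betw_finite_nat finite_verts by blast
  then have inj: "f x = f y \<Longrightarrow> x = y" if "x \<in> verts G" "y \<in> verts G" for x y
    using that by (meson bij_betw_imp_inj_on inj_onD)
  have "rs_colouring G (card (verts G)) f"
    unfolding rs_colouring_def
  proof (intro conjI)
    show "\<forall>x\<in>verts G. f x \<in> {0..<card (verts G)}"
      using f bij_betwE by blast
    show "\<forall>x y. x \<rightarrow>\<^bsub>G\<^esub> y \<longrightarrow> f x \<noteq> f y"
      using inj adj_in_verts adj_not_same by metis
    show "\<not> (\<exists>x y z. vpath [x, y, z] G \<and> f y > f x \<and> f x = f z)"
      using inj by (auto simp: vpath_def vwalk_def)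
  qed
  then show ?thesis
    unfolding rs_chromatic_number_def
    by (intro LeastI[of "\<lambda>k. \<exists>f. rs_colouring G k f"]) blast
qed

end

theory Submission
  imports Defs
begin

text \<open>
  Giving all vertices of a maximum independent set the largest colour, and distinct smaller colours
  to the other vertices, is a restricted star colouring. Conversely, let the vertices be partitioned
  into a clique \<open>K\<close> and an independent set \<open>I\<close>. A colouring is injective on \<open>K\<close>, and if it uses no
  colour outside \<open>K\<close>, then the vertex \<open>v\<close> of \<open>K\<close> of the largest colour has no neighbour \<open>w\<close> in \<open>I\<close>:
  the vertex \<open>u\<close> of \<open>K\<close> with the colour of \<open>w\<close> would give a forbidden path \<open>u, v, w\<close>. Hence
  \<open>K\<close> misses a colour unless \<open>insert v I\<close> is independent.
\<close>

lemma (in graph) card_le_independence_number: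
  assumes "independent_set G S"
  shows "card S \<le> independence_number G"
  unfolding independence_number_def using assms finite_independent_sets by (intro Max_ge) auto

lemma rs_chromatic_number_le:
  assumes "rs_colouring G k f"
  shows "rs_chromatic_number G \<le> k"
  unfolding rs_chromatic_number_def using assms by (intro Least_le) blast

lemma (in graph) rs_chromatic_number_le_independent_set:
  assumes S: "independent_set G S"
  shows "rs_chromatic_number G \<le> card (verts G) - card S + 1"
proof -
  define m where "m = card (verts G - S)"
  have sub: "S \<subseteq> verts G" and indep: "\<And>x y. x \<in> S \<Longrightarrow> y \<in> S \<Longrightarrow> \<not> x \<rightarrow>\<^bsub>G\<^esub> y"
    using S by (auto simp: independent_set_def)
  obtain g :: "'a \<Rightarrow> nat" where g: "bij_betw g (verts G - S) {0..<m}"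
    unfolding m_def using ex_bij_betw_finite_nat finite_verts by blast
  have inj: "inj_on g (verts G - S)" and less: "\<And>x. x \<in> verts G - S \<Longrightarrow> g x < m"
    using g by (auto simp: bij_betw_def)
  define f where "f x = (if x \<in> S then m else g x)" for x
  have le: "f x \<le> m" if "x \<in> verts G" for x
    using less[of x] that by (auto simp: f_def)
  \<comment> \<open>All values of \<open>g\<close> on vertices outside \<open>S\<close> lie below
    \<open>m\<close>, so among the vertices the colour \<open>m\<close> occurs on \<open>S\<close>
    alone and is the only one that can repeat.\<close>
  have same: "x = y \<or> x \<in> S \<and> y \<in> S" if "x \<in> verts G" "y \<in> verts G" "f x = f y" for x y
    using that less[of x] less[of y] inj_onD[OF inj, of x y] by (auto simp: f_def split: if_splits)
  have "rs_colouring G (m + 1) f"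
    unfolding rs_colouring_def
  proof (intro conjI)
    show "\<forall>x\<in>verts G. f x \<in> {0..<m + 1}"
      using le by (auto simp: less_Suc_eq_le)
    show "\<forall>x y. x \<rightarrow>\<^bsub>G\<^esub> y \<longrightarrow> f x \<noteq> f y"
      using same indep adj_in_verts adj_not_same by metis
    show "\<not> (\<exists>x y z. vpath [x, y, z] G \<and> f y > f x \<and> f x = f z)"
    proof clarify
      fix x y z
      assume *: "vpath [x, y, z] G" "f y > f x" "f x = f z"
      then have "x \<in> verts G" "y \<in> verts G" "z \<in> verts G" "x \<noteq> z"
        by (auto simp: vpath_def vwalk_def)
      \<comment> \<open>Distinct ends of one colour must carry \<open>m\<close>, which
        \<open>f y\<close> cannot exceed.\<close>
      with same[of x z] *(3) have "x \<in> S"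
        by blast
      with le[OF \<open>y \<in> verts G\<close>] *(2) show False
        by (simp add: f_def)
    qed
  qed
  moreover have "m = card (verts G) - card S"
    unfolding m_def using sub finite_verts by (meson card_Diff_subset finite_subset)
  ultimately show ?thesis
    using rs_chromatic_number_le by blast
qed

lemma rs_colouring_inj_on_clique:
  assumes "clique G K" "rs_colouring G k f"
  shows "inj_on f K"
  using assms unfolding clique_def rs_colouring_def inj_on_def by metis

lemma (in graph) ex_clique_vertex_without_neighbour:
  assumes K: "clique G K" "K \<noteq> {}"
    and f: "rs_colouring G k f" "k \<le> card K"
    and disj: "K \<inter> I = {}"
  obtains v where "v \<in> K" "\<And>w. w \<in> I \<Longrightarrow> \<not> v \<rightarrow>\<^bsub>G\<^esub> w"
proof -
  have sub: "K \<subseteq> verts G"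
    using K by (simp add: clique_def)
  then have fin: "finite K"
    using finite_verts finite_subset by blast
  have "f ` K \<subseteq> {0..<k}"
    using f sub by (auto simp: rs_colouring_def)
  moreover have "card {0..<k} \<le> card (f ` K)"
    using f rs_colouring_inj_on_clique[OF K(1) f(1)] by (simp add: card_image)
  ultimately have image: "f ` K = {0..<k}"
    by (intro card_seteq) auto
  obtain v where v: "v \<in> K" and max: "\<And>u. u \<in> K \<Longrightarrow> f u \<le> f v"
    using Max_in[of "f ` K"] Max_ge[of "f ` K"] fin K(2) by (metis empty_is_image finite_imageI imageE imageI)
  moreover have "\<not> v \<rightarrow>\<^bsub>G\<^esub> w" if w: "w \<in> I" for w
  proof
    assume vw: "v \<rightarrow>\<^bsub>G\<^esub> w"
    then have "w \<in> verts G"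
      by (rule adj_in_verts)
    then obtain u where u: "u \<in> K" "f u = f w"
      using f(1) image unfolding rs_colouring_def by (metis imageE)
    have "f v \<noteq> f w"
      using f(1) vw by (auto simp: rs_colouring_def)
    with u have "u \<noteq> v"
      by metis
    with K(1) u(1) v have "u \<rightarrow>\<^bsub>G\<^esub> v"
      by (simp add: clique_def)
    moreover have "u \<noteq> w" "v \<noteq> w"
      using u(1) v w disj by auto
    ultimately have "vpath [u, v, w] G"
      using vw \<open>u \<noteq> v\<close> \<open>w \<in> verts G\<close> u(1) v sub by (auto simp: vpath_def vwalk_def)
    moreover have "f v > f u"
      using max[OF u(1)] u(2) \<open>f v \<noteq> f w\<close> by simp
    ultimately show False
      using f(1) u(2) unfolding rs_colouring_def by blast
  qed
  ultimately show ?thesis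
    using that by blast
qed

lemma (in graph) rs_colouring_lower_bound:
  assumes part: "K \<union> I = verts G" "K \<inter> I = {}" "clique G K" "independent_set G I"
    and f: "rs_colouring G k f"
    and nonempty: "verts G \<noteq> {}"
  shows "card (verts G) - independence_number G + 1 \<le> k"
proof -
  have fin: "finite K" "finite I"
    using part(1) finite_verts by (metis finite_Un)+
  have n: "card (verts G) = card K + card I"
    using part(1,2) fin card_Un_disjoint by metis
  have I_le: "card I \<le> independence_number G"
    using part(4) by (rule card_le_independence_number)
  have "k > 0"
    using f nonempty by (auto simp: rs_colouring_def)
  have "f ` K \<subseteq> {0..<k}"
    using f part(1) by (auto simp: rs_colouring_def)
  then have K_le: "card K \<le> k"
    using card_mono[of "{0..<k}" "f ` K"] card_image[OF rs_colouring_inj_on_clique[OF part(3) f]] by simp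
  \<comment> \<open>If \<open>K\<close> is empty, the bound is 1; if \<open>card K < k\<close>, the
    spare colour suffices. Otherwise \<open>card K = k\<close>.\<close>
  show ?thesis
  proof (cases "K = {} \<or> card K < k")
    case True
    with n I_le \<open>k > 0\<close> show ?thesis
      by auto
  next
    case False
    then obtain v where v: "v \<in> K" "\<And>w. w \<in> I \<Longrightarrow> \<not> v \<rightarrow>\<^bsub>G\<^esub> w"
      using ex_clique_vertex_without_neighbour[OF part(3) _ f _ part(2)] by (metis not_less)
    have "\<not> w \<rightarrow>\<^bsub>G\<^esub> v" if "w \<in> I" for w
      using v(2)[OF that] arcs_ends_symmetric[OF sym_arcs] by blast
    moreover have "\<not> v \<rightarrow>\<^bsub>G\<^esub> v"
      using adj_not_same by blast
    ultimately have "independent_set G (insert v I)"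
      using v part(1,4) by (auto simp: independent_set_def)
    \<comment> \<open>Enlarging \<open>I\<close> by \<open>v\<close> lowers
      \<open>card (verts G) - independence_number G\<close> to at most
      \<open>card K - 1\<close>.\<close>
    from card_le_independence_number[OF this] have "card I + 1 \<le> independence_number G"
      using v(1) part(2) fin by (metis Suc_eq_plus1 card_insert_disjoint disjoint_iff)
    with n K_le \<open>k > 0\<close> show ?thesis
      by linarith
  qed
qed

text \<open>The empty graph is excluded because it needs 0 colours, while the formula yields
  1.\<close>

theorem theorem7:
  fixes G :: "('a, 'b) pre_digraph"
  assumes "split_graph G"
    and "verts G \<noteq> {}"
    and "card (verts G) = n"
  shows "rs_chromatic_number G = n - independence_number G + 1"
proof (rule antisym)
  interpret graph G
    using assms(1) by (simp add: split_graph_def)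
  obtain S where "independent_set G S" "card S = independence_number G"
    using independence_number_attained by blast
  with rs_chromatic_number_le_independent_set[of S] assms(3)
  show "rs_chromatic_number G \<le> n - independence_number G + 1"
    by simp
  obtain K I where "K \<union> I = verts G" "K \<inter> I = {}" "clique G K" "independent_set G I"
    using assms(1) unfolding split_graph_def by blast
  moreover obtain f where "rs_colouring G (rs_chromatic_number G) f"
    using rs_chromatic_number_attained by blast
  ultimately show "n - independence_number G + 1 \<le> rs_chromatic_number G"
    using rs_colouring_lower_bound assms(2,3) by blast
qed

end
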